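(* Let $\beta>1$ be a real number, let $c\in\mathbb{Z}_{\ge1}$, let $C=\{-c,-c+1,\ldots,0,\ldots,c\}$, let $n\ge 1$ and $\mathbf{C}=C^n$. For a set $X\subset\mathbb{R}^n$, the following are equivalent: (i) $X$ is a $(\beta,C)$-acceptable set having an underlying trim Büchi automaton that is closed, i.e. there is a trim closed Büchi automaton $\mathcal{A}$ over $\mathbf{C}$ such that $\mathrm{val}_\beta(\mathbf{0}\star L(\mathcal{A}))=X$; (ii) $X$ is a finite union of compact sets belonging to the attractor of a GDIFS whose similarities are of the form $S_{\mathbf{a}}(\mathbf{x})=\frac{\mathbf{x}+\mathbf{a}}{\beta}$ for $\mathbf{a}\in\mathbf{C}$.
   Context: Büchi automata. A Büchi automaton over a finite alphabet $A$ is a tuple $(Q,A,E,I,T)$ with $Q$ a finite set of states, $E\subseteq Q\times A\times Q$ the transitions, $I\subseteq Q$ the initial states and $T\subseteq Q$ the terminal (final) states. It accepts an infinite word $u\in A^\omega$ if $u$ labels an infinite path starting in a state of $I$ and visiting $T$ infinitely often; $L(\mathcal{A})$ denotes the set of infinite words accepted by $\mathcal{A}$. A state $q$ is accessible (resp. co-accessible) if there is a path from $I$ to $q$ (resp. from $q$ to $T$). An automaton is trim if all its states are accessible and co-accessible. An automaton is closed if every state $q$ such that there is a nonempty path from $q$ to $q$ is final. Acceptable sets. For an infinite word $\mathbf{w}=\mathbf{w}_1\mathbf{w}_2\cdots\in\mathbf{C}^\omega$, put $\mathrm{val}_\beta(\mathbf{0}\star\mathbf{w})=\sum_{i\ge1}\mathbf{w}_i\beta^{-i}\in\mathbb{R}^n$,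 and for $L\subseteq\mathbf{C}^\omega$ let $\mathrm{val}_\beta(\mathbf{0}\star L)=\{\mathrm{val}_\beta(\mathbf{0}\star\mathbf{w})\mid\mathbf{w}\in L\}$. A set $X\subset\mathbb{R}^n$ is $(\beta,C)$-acceptable if there exists a Büchi automaton $\mathcal{A}$ over $\mathbf{C}$ such that $\mathrm{val}_\beta(\mathbf{0}\star L(\mathcal{A}))=X$; such an $\mathcal{A}$ is called an underlying automaton for $X$. GDIFS. A graph-directed iterated function system (GDIFS) is given by a finite directed graph $(V,E)$ (multiple edges and loops allowed) in which every vertex has at least one outgoing edge, metric spaces $(X_v,\rho_v)_{v\in V}$ and, for every edge $e$ from $u$ to $v$, a similarity $S_e:X_v\to X_u$. Here all metric spaces are $\mathbb{R}^n$ with the Euclidean distance. An attractor is a list $(K_v)_{v\in V}$ of nonempty compact sets $K_v\subset X_v$ such that for all $u\in V$, $K_u=\bigcup_{v\in V}\bigcup_{e\in E_{uv}}S_e(K_v)$, where $E_{uv}$ is the set of edges from $u$ to $v$. When all similarities have ratio less than $1$, the attractor exists and is unique. A compact set "belongs to the attractor" if it is one of the sets $K_v$. *)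

theory Defs
  imports "HOL-Analysis.Analysis" "Graph_Theory.Digraph"
begin

record ('q, 'a) buchi =
  states :: "'q set"
  trans :: "('q \<times> 'a \<times> 'q) set"
  initial :: "'q set"
  final :: "'q set"

definition buchi_automaton :: "'a set \<Rightarrow> ('q, 'a) buchi \<Rightarrow> bool" where
  "buchi_automaton A \<A> \<longleftrightarrow>
     finite (states \<A>) \<and> trans \<A> \<subseteq> states \<A> \<times> A \<times> states \<A> \<and>
     initial \<A> \<subseteq> states \<A> \<and> final \<A> \<subseteq> states \<A>"

definition buchi_accepts :: "('q, 'a) buchi \<Rightarrow> (nat \<Rightarrow> 'a) \<Rightarrow> bool" where
  "buchi_accepts \<A> u \<longleftrightarrow>
     (\<exists>\<rho>. \<rho> 0 \<in> initial \<A> \<and> (\<forall>i. (\<rho> i, u i, \<rho> (Suc i)) \<in> trans \<A>) \<and>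
          (\<exists>\<^sub>\<infinity>i. \<rho> i \<in> final \<A>))"

definition buchi_lang :: "('q, 'a) buchi \<Rightarrow> (nat \<Rightarrow> 'a) set" where
  "buchi_lang \<A> = {u. buchi_accepts \<A> u}"

definition step_rel :: "('q, 'a) buchi \<Rightarrow> ('q \<times> 'q) set" where
  "step_rel \<A> = {(p, q). \<exists>a. (p, a, q) \<in> trans \<A>}"

definition accessible :: "('q, 'a) buchi \<Rightarrow> 'q \<Rightarrow> bool" where
  "accessible \<A> q \<longleftrightarrow> (\<exists>p\<in>initial \<A>. (p, q) \<in> (step_rel \<A>)\<^sup>*)"

definition coaccessible :: "('q, 'a) buchi \<Rightarrow> 'q \<Rightarrow> bool" where
  "coaccessible \<A> q \<longleftrightarrow> (\<exists>p\<in>final \<A>. (q, p) \<in> (step_rel \<A>)\<^sup>*)"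

definition buchi_trim :: "('q, 'a) buchi \<Rightarrow> bool" where
  "buchi_trim \<A> \<longleftrightarrow> (\<forall>q\<in>states \<A>. accessible \<A> q \<and> coaccessible \<A> q)"

definition buchi_closed :: "('q, 'a) buchi \<Rightarrow> bool" where
  "buchi_closed \<A> \<longleftrightarrow> (\<forall>q\<in>states \<A>. (q, q) \<in> (step_rel \<A>)\<^sup>+ \<longrightarrow> q \<in> final \<A>)"

definition letters :: "int set \<Rightarrow> (int ^ 'n) set" where
  "letters C = {a. \<forall>i. a $ i \<in> C}"

definition real_vec :: "int ^ 'n \<Rightarrow> real ^ 'n" where
  "real_vec a = (\<chi> i. real_of_int (a $ i))"

text \<open>The value of the word with integer part \<open>0\<close> and fractional part \<open>w\<close>. Words are
  indexed from \<open>0\<close>, so the letter at index \<open>i\<close> has weight \<open>1 / \<beta> ^ (i + 1)\<close>.\<close>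

definition val_frac :: "real \<Rightarrow> (nat \<Rightarrow> int ^ 'n) \<Rightarrow> real ^ 'n" where
  "val_frac \<beta> w = (\<Sum>i. (1 / \<beta> ^ Suc i) *\<^sub>R real_vec (w i))"

definition underlying_automaton ::
    "real \<Rightarrow> int set \<Rightarrow> ('q, int ^ 'n) buchi \<Rightarrow> (real ^ 'n) set \<Rightarrow> bool" where
  "underlying_automaton \<beta> C \<A> X \<longleftrightarrow>
     buchi_automaton (letters C) \<A> \<and> val_frac \<beta> ` buchi_lang \<A> = X"

text \<open>State sets are finite, so taking the states to be natural numbers loses no generality.\<close>

definition acceptable :: "real \<Rightarrow> int set \<Rightarrow> (real ^ 'n) set \<Rightarrow> bool" where
  "acceptable \<beta> C X \<longleftrightarrow> (\<exists>\<A> :: (nat, int ^ 'n) buchi. underlying_automaton \<beta> C \<A> X)"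

definition similarity :: "('x::metric_space \<Rightarrow> 'x) \<Rightarrow> bool" where
  "similarity f \<longleftrightarrow> (\<exists>r>0. \<forall>x y. dist (f x) (f y) = r * dist x y)"

text \<open>All vertices carry the same metric space, the type \<open>'x\<close>. The map of an arc goes
  against the arc: it sends the space of the head to the space of the tail.\<close>

locale gdifs = fin_digraph G
  for G :: "('v, 'e) pre_digraph" +
  fixes S :: "'e \<Rightarrow> 'x::metric_space \<Rightarrow> 'x"
  assumes out_arcs_nonempty: "v \<in> verts G \<Longrightarrow> out_arcs G v \<noteq> {}"
    and similarity: "e \<in> arcs G \<Longrightarrow> similarity (S e)"

definition is_attractor ::
    "('v, 'e) pre_digraph \<Rightarrow> ('e \<Rightarrow> 'x::metric_space \<Rightarrow> 'x) \<Rightarrow> ('v \<Rightarrow> 'x set) \<Rightarrow> bool" where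
  "is_attractor G S K \<longleftrightarrow>
     (\<forall>v\<in>verts G. K v \<noteq> {} \<and> compact (K v)) \<and>
     (\<forall>u\<in>verts G. K u =
        (\<Union>v\<in>verts G. \<Union>e\<in>{e \<in> arcs G. tail G e = u \<and> head G e = v}. S e ` K v))"

definition digit_map :: "real \<Rightarrow> int ^ 'n \<Rightarrow> real ^ 'n \<Rightarrow> real ^ 'n" where
  "digit_map \<beta> a x = (x + real_vec a) /\<^sub>R \<beta>"

end

theory Submission imports Defs begin

text \<open>
  An automaton over \<open>letters C\<close> and a graph-directed iterated function system built from the
  maps \<open>digit_map \<beta> a\<close> are the same picture: a transition \<open>(p, a, q)\<close> is an arc from \<open>p\<close> to
  \<open>q\<close> carrying \<open>digit_map \<beta> a\<close>. Prepending the letter \<open>a\<close> to a word \<open>w\<close> turns its value \<open>x\<close>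
  into \<open>(x + a) / \<beta>\<close>, so the values of the infinite paths that start in the various vertices
  satisfy the attractor equations.

  These sets of values are compact, because the infinite paths from a vertex form a closed
  subset of the compact space of all sequences over the finite set of arcs, on which the value
  is continuous. Hence they form an attractor (\<open>address_val_ipaths_is_attractor\<close>). Every
  attractor is of this form (\<open>attractor_eq_address_val_ipaths\<close>), as the maps contract by
  \<open>1 / \<beta>\<close>: a point of \<open>K v\<close> can be pulled back along arcs for ever and is the value of the
  path found in this way, and conversely the value of a path is a limit of points of the closed
  set \<open>K v\<close>.

  It remains to compare acceptance with the mere existence of a path. In a closed automaton the
  two agree (\<open>closed_run_accepting\<close>): a run revisits some state infinitely often, that state
  lies on a cycle, and so it is final. Thus the accepted words are exactly the labels of the
  infinite paths from the initial states, and the set of their values is a union of sets of the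
  attractor. A graph-directed system requires an outgoing arc at every vertex, so states without
  an infinite run are discarded on the way from automata to systems; on the way back, all
  vertices are made final and those that no chosen vertex reaches are discarded to obtain a trim
  automaton.
\<close>

section \<open>Expansions in base \<open>\<beta>\<close>\<close>

lemma summable_geometric_weights:
  fixes \<beta> :: real
  assumes "\<beta> > 1"
  shows "summable (\<lambda>i. M / \<beta> ^ Suc i)"
proof -
  have "summable (\<lambda>i. (1 / \<beta>) ^ i)"
    using assms by (intro summable_geometric) auto
  then have "summable (\<lambda>i. (M / \<beta>) * (1 / \<beta>) ^ i)"
    by (rule summable_mult)
  then show ?thesis
    by (simp add: power_divide)
qed

lemma digit_map_expansion:
  assumes "\<beta> > 0"
  shows "(1 / \<beta> ^ N) *\<^sub>R digit_map \<beta> b x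
    = (1 / \<beta> ^ Suc N) *\<^sub>R real_vec b + (1 / \<beta> ^ Suc N) *\<^sub>R x"
  using assms by (simp add: digit_map_def scaleR_add_right field_simps)

lemma similarity_digit_map:
  assumes "\<beta> > 0"
  shows "similarity (digit_map \<beta> b)"
proof -
  have "dist (digit_map \<beta> b x) (digit_map \<beta> b y) = inverse \<beta> * dist x y" for x y
    using assms
    by (simp add: digit_map_def dist_norm flip: scaleR_diff_right)
  then show ?thesis
    unfolding similarity_def using assms by (intro exI[of _ "inverse \<beta>"]) auto
qed

lemma remainder_tendsto_0:
  fixes x :: "nat \<Rightarrow> 'x::real_normed_vector"
  assumes "\<beta> > 1" and "bounded (range x)"
  shows "(\<lambda>N. (1 / \<beta> ^ N) *\<^sub>R x N) \<longlonglongrightarrow> 0"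
proof -
  obtain M where M: "\<And>N. norm (x N) \<le> M"
    using assms(2) by (auto simp: bounded_iff)
  have "(\<lambda>N. M * (1 / \<beta>) ^ N) \<longlonglongrightarrow> M * 0"
    using assms(1) by (intro tendsto_mult_left LIMSEQ_power_zero) auto
  then show ?thesis
    by (rule Lim_null_comparison[rotated, OF tendsto_eq_rhs])
      (use assms(1) M in \<open>auto simp: power_divide divide_right_mono\<close>)
qed

text \<open>Unrolling the recursion \<open>N\<close> times writes \<open>x 0\<close> as a partial sum of the series plus
  \<open>x N / \<beta> ^ N\<close>, and boundedness makes this remainder vanish.\<close>

lemma val_frac_eqI:
  assumes "\<beta> > 1" and "bounded (range x)"
    and step: "\<And>i. x i = digit_map \<beta> (w i) (x (Suc i))"
  shows "val_frac \<beta> w = x 0"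
proof -
  have sum_eq: "(\<Sum>i<N. (1 / \<beta> ^ Suc i) *\<^sub>R real_vec (w i)) = x 0 - (1 / \<beta> ^ N) *\<^sub>R x N" for N
  proof (induction N)
    case (Suc N)
    have "(1 / \<beta> ^ N) *\<^sub>R x N
        = (1 / \<beta> ^ Suc N) *\<^sub>R real_vec (w N) + (1 / \<beta> ^ Suc N) *\<^sub>R x (Suc N)"
      by (subst step) (use assms(1) in \<open>simp only: digit_map_expansion\<close>)
    with Suc show ?case
      by (simp add: algebra_simps)
  qed simp
  have "(\<lambda>i. (1 / \<beta> ^ Suc i) *\<^sub>R real_vec (w i)) sums (x 0 - 0)"
    unfolding sums_def sum_eq
    by (intro tendsto_intros remainder_tendsto_0 assms)
  then show ?thesis
    unfolding val_frac_def by (simp add: sums_iff)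
qed

lemma norm_digit_term_le:
  assumes "\<beta> > 1" and "norm (real_vec b) \<le> M"
  shows "norm ((1 / \<beta> ^ Suc i) *\<^sub>R real_vec b) \<le> M / \<beta> ^ Suc i"
proof -
  have "norm ((1 / \<beta> ^ Suc i) *\<^sub>R real_vec b) = norm (real_vec b) / \<beta> ^ Suc i"
    using assms(1) by (simp del: power_Suc)
  also have "\<dots> \<le> M / \<beta> ^ Suc i"
    using assms by (intro divide_right_mono) auto
  finally show ?thesis .
qed

lemma summable_val_frac:
  assumes "\<beta> > 1" and "\<And>i. norm (real_vec (w i)) \<le> M"
  shows "summable (\<lambda>i. (1 / \<beta> ^ Suc i) *\<^sub>R real_vec (w i))"
  by (rule summable_comparison_test'[OF summable_geometric_weights[OF assms(1), of M], of 0])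
    (intro norm_digit_term_le assms)

text \<open>The self-similarity behind the whole argument: putting a letter in front of a word
  applies the map of that letter to the value.\<close>

lemma val_frac_Suc:
  assumes "\<beta> > 1" and "\<And>i. norm (real_vec (w i)) \<le> M"
  shows "val_frac \<beta> w = digit_map \<beta> (w 0) (val_frac \<beta> (\<lambda>i. w (Suc i)))"
proof -
  have tail_sum: "summable (\<lambda>i. (1 / \<beta> ^ Suc i) *\<^sub>R real_vec (w (Suc i)))"
    using assms by (rule summable_val_frac)
  have "val_frac \<beta> w = (1 / \<beta>) *\<^sub>R real_vec (w 0)
      + (\<Sum>i. (1 / \<beta> ^ Suc (Suc i)) *\<^sub>R real_vec (w (Suc i)))"
    unfolding val_frac_def by (subst suminf_split_head[OF summable_val_frac[OF assms]]) auto
  also have "(\<Sum>i. (1 / \<beta> ^ Suc (Suc i)) *\<^sub>R real_vec (w (Suc i)))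
      = (1 / \<beta>) *\<^sub>R val_frac \<beta> (\<lambda>i. w (Suc i))"
    unfolding val_frac_def by (subst suminf_scaleR_right[OF tail_sum]) simp
  finally show ?thesis
    by (simp add: digit_map_def divide_inverse algebra_simps)
qed

section \<open>The attractor in terms of infinite paths\<close>

text \<open>Paths are sequences of arcs rather than of vertices: parallel arcs may carry different
  digits.\<close>

definition ipaths :: "('v, 'e) pre_digraph \<Rightarrow> 'v \<Rightarrow> (nat \<Rightarrow> 'e) set" where
  "ipaths G v = {\<pi>. tail G (\<pi> 0) = v \<and>
     (\<forall>i. \<pi> i \<in> arcs G \<and> head G (\<pi> i) = tail G (\<pi> (Suc i)))}"

lemma ipaths_Cons:
  "ipaths G v = (\<Union>e\<in>out_arcs G v. case_nat e ` ipaths G (head G e))"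
proof (intro equalityI subsetI)
  fix \<pi> assume \<pi>: "\<pi> \<in> ipaths G v"
  have "\<pi> = case_nat (\<pi> 0) (\<lambda>i. \<pi> (Suc i))"
    by (auto split: nat.split)
  moreover have "(\<lambda>i. \<pi> (Suc i)) \<in> ipaths G (head G (\<pi> 0))" "\<pi> 0 \<in> out_arcs G v"
    using \<pi> by (auto simp: ipaths_def out_arcs_def)
  ultimately show "\<pi> \<in> (\<Union>e\<in>out_arcs G v. case_nat e ` ipaths G (head G e))"
    by blast
next
  fix \<pi> assume "\<pi> \<in> (\<Union>e\<in>out_arcs G v. case_nat e ` ipaths G (head G e))"
  then show "\<pi> \<in> ipaths G v"
    by (auto simp: ipaths_def out_arcs_def split: nat.split)
qed

text \<open>By Tychonoff's theorem the sequences over a finite set of arcs form a compact space for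
  the product of the discrete topologies. Being a path from \<open>v\<close> is a conjunction of conditions
  that each look at only two coordinates, hence a closed condition.\<close>

lemma compact_ipaths:
  fixes G :: "('v, 'e::discrete_topology) pre_digraph"
  assumes "finite (arcs G)"
  shows "compact (ipaths G v)"
proof -
  have discrete: "closed {\<pi> :: nat \<Rightarrow> 'e. P (\<pi> i) (\<pi> j)}" for P i j
  proof -
    have "continuous_on UNIV (\<lambda>\<pi> :: nat \<Rightarrow> 'e. (\<pi> i, \<pi> j))"
      by (intro continuous_on_Pair continuous_on_product_coordinates)
    moreover have "closed {p :: 'e \<times> 'e. P (fst p) (snd p)}"
    proof -
      have "open A" for A :: "('e \<times> 'e) set"
      proof (subst open_subopen, rule ballI)
        fix p assume "p \<in> A"
        moreover have "open ({fst p} \<times> {snd p})"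
          by (intro open_Times open_discrete)
        ultimately show "\<exists>T. open T \<and> p \<in> T \<and> T \<subseteq> A"
          by (intro exI[of _ "{fst p} \<times> {snd p}"]) auto
      qed
      then show ?thesis by (simp add: closed_def)
    qed
    ultimately have "closed ((\<lambda>\<pi>. (\<pi> i, \<pi> j)) -` {p. P (fst p) (snd p)})"
      by (rule closed_vimage[rotated])
    then show ?thesis by (simp add: vimage_def)
  qed
  have "compactin (product_topology (\<lambda>_. euclidean) UNIV) (PiE UNIV (\<lambda>_::nat. arcs G))"
    using assms by (simp add: compactin_PiE finite_imp_compact)
  then have "compact (PiE UNIV (\<lambda>_::nat. arcs G))"
    by (simp add: euclidean_product_topology)
  moreover have "closed ({\<pi>. tail G (\<pi> 0) = v} \<inter> (\<Inter>i. {\<pi>. head G (\<pi> i) = tail G (\<pi> (Suc i))}))"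
    using discrete[of "\<lambda>x y. tail G x = v" 0 0] discrete[of "\<lambda>x y. head G x = tail G y"]
    by (intro closed_Int closed_INT) auto
  ultimately have "compact (PiE UNIV (\<lambda>_::nat. arcs G) \<inter>
      ({\<pi>. tail G (\<pi> 0) = v} \<inter> (\<Inter>i. {\<pi>. head G (\<pi> i) = tail G (\<pi> (Suc i))})))"
    by (rule compact_Int_closed)
  also have "PiE UNIV (\<lambda>_::nat. arcs G) \<inter>
      ({\<pi>. tail G (\<pi> 0) = v} \<inter> (\<Inter>i. {\<pi>. head G (\<pi> i) = tail G (\<pi> (Suc i))})) = ipaths G v"
    by (auto simp: ipaths_def PiE_def)
  finally show ?thesis .
qed

text \<open>The discrete topology on arcs gives spaces of arc sequences the product topology that
  the compactness argument needs.\<close>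

locale digit_gdifs = gdifs G S
  for G :: "('v, 'e::discrete_topology) pre_digraph" and S :: "'e \<Rightarrow> real ^ 'n \<Rightarrow> real ^ 'n" +
  fixes \<beta> :: real and a :: "'e \<Rightarrow> int ^ 'n"
  assumes base_gt_1: "\<beta> > 1"
    and digit: "e \<in> arcs G \<Longrightarrow> S e = digit_map \<beta> (a e)"
begin

definition address_val :: "(nat \<Rightarrow> 'e) \<Rightarrow> real ^ 'n" where
  "address_val \<pi> = val_frac \<beta> (\<lambda>i. a (\<pi> i))"

lemma obtain_digit_bound:
  obtains M where "\<And>e. e \<in> arcs G \<Longrightarrow> norm (real_vec (a e)) \<le> M"
proof -
  have "bdd_above ((\<lambda>e. norm (real_vec (a e))) ` arcs G)"
    by simp
  then show thesis
    using that by (auto simp: bdd_above_def)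
qed

lemma address_val_Cons:
  assumes "e \<in> out_arcs G v" and "\<pi> \<in> ipaths G (head G e)"
  shows "address_val (case_nat e \<pi>) = S e (address_val \<pi>)"
proof -
  obtain M where M: "\<And>e. e \<in> arcs G \<Longrightarrow> norm (real_vec (a e)) \<le> M"
    using obtain_digit_bound by blast
  have "norm (real_vec (a (case_nat e \<pi> i))) \<le> M" for i
    using assms by (intro M) (auto simp: ipaths_def out_arcs_def split: nat.split)
  from val_frac_Suc[OF base_gt_1 this] show ?thesis
    using assms by (simp add: address_val_def digit out_arcs_def)
qed

text \<open>The partial sums depend on finitely many coordinates, and the digits of a finite graph
  are bounded, so the series converges uniformly by the Weierstrass criterion.\<close>

lemma continuous_on_address_val: "continuous_on (ipaths G v) address_val"
proof -
  obtain M where M: "\<And>e. e \<in> arcs G \<Longrightarrow> norm (real_vec (a e)) \<le> M"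
    using obtain_digit_bound by blast
  have cont: "continuous_on (ipaths G v)
      (\<lambda>\<pi>. \<Sum>i<N. (1 / \<beta> ^ Suc i) *\<^sub>R real_vec (a (\<pi> i)))" for N
  proof (intro continuous_intros)
    fix i
    have "continuous_on (ipaths G v) (\<lambda>\<pi>. \<pi> i)"
      by (rule continuous_on_subset[OF continuous_on_product_coordinates subset_UNIV])
    then show "continuous_on (ipaths G v) (\<lambda>\<pi>. real_vec (a (\<pi> i)))"
      by (rule continuous_on_compose2[OF Topological_Spaces.continuous_on_discrete _ subset_UNIV])
  qed
  have "norm ((1 / \<beta> ^ Suc i) *\<^sub>R real_vec (a (\<pi> i))) \<le> M / \<beta> ^ Suc i"
    if "\<pi> \<in> ipaths G v" for i \<pi>
    using that by (intro norm_digit_term_le base_gt_1 M) (auto simp: ipaths_def)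
  then have "uniform_limit (ipaths G v) (\<lambda>N \<pi>. \<Sum>i<N. (1 / \<beta> ^ Suc i) *\<^sub>R real_vec (a (\<pi> i)))
      (\<lambda>\<pi>. \<Sum>i. (1 / \<beta> ^ Suc i) *\<^sub>R real_vec (a (\<pi> i))) sequentially"
    using summable_geometric_weights[OF base_gt_1] by (rule Weierstrass_m_test)
  then show ?thesis
    unfolding address_val_def val_frac_def
    by (rule uniform_limit_theorem[OF always_eventually[OF allI[OF cont]] _ sequentially_bot])
qed

lemma ipaths_nonempty:
  assumes "v \<in> verts G"
  shows "ipaths G v \<noteq> {}"
proof -
  have "\<exists>\<pi>. \<forall>i. (\<pi> i \<in> arcs G \<and> (i = 0 \<longrightarrow> tail G (\<pi> i) = v)) \<and> head G (\<pi> i) = tail G (\<pi> (Suc i))"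
  proof (rule dependent_nat_choice)
    show "\<exists>e. e \<in> arcs G \<and> (0 = (0::nat) \<longrightarrow> tail G e = v)"
      using out_arcs_nonempty[OF assms] by (auto simp: out_arcs_def)
  next
    fix e and n :: nat
    assume "e \<in> arcs G \<and> (n = 0 \<longrightarrow> tail G e = v)"
    then show "\<exists>f. (f \<in> arcs G \<and> (Suc n = 0 \<longrightarrow> tail G f = v)) \<and> head G e = tail G f"
      using out_arcs_nonempty[of "head G e"] by (auto simp: out_arcs_def)
  qed
  then show ?thesis
    by (auto simp: ipaths_def)
qed

lemma attractor_Union_out_arcs:
  assumes "u \<in> verts G"
  shows "(\<Union>v\<in>verts G. \<Union>e\<in>{e \<in> arcs G. tail G e = u \<and> head G e = v}. S e ` K v)
    = (\<Union>e\<in>out_arcs G u. S e ` K (head G e))"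
  using head_in_verts by (fastforce simp: out_arcs_def)

lemma attractorD:
  assumes "is_attractor G S K" and "u \<in> verts G"
  shows "K u \<noteq> {}" and "compact (K u)"
    and "K u = (\<Union>e\<in>out_arcs G u. S e ` K (head G e))"
proof -
  note K = assms(1)[unfolded is_attractor_def]
  show "K u \<noteq> {}" "compact (K u)"
    using bspec[OF conjunct1[OF K] assms(2)] by blast+
  show "K u = (\<Union>e\<in>out_arcs G u. S e ` K (head G e))"
    using bspec[OF conjunct2[OF K] assms(2)]
    by (simp only: attractor_Union_out_arcs[OF assms(2)])
qed

text \<open>The attractor equation is the decomposition of paths by their first arc.\<close>

theorem address_val_ipaths_is_attractor: "is_attractor G S (\<lambda>v. address_val ` ipaths G v)"
  unfolding is_attractor_def
proof (intro conjI ballI)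
  fix v assume "v \<in> verts G"
  then show "address_val ` ipaths G v \<noteq> {}"
    by (simp add: ipaths_nonempty)
  show "compact (address_val ` ipaths G v)"
    by (intro compact_continuous_image continuous_on_address_val compact_ipaths) simp
next
  fix u assume u: "u \<in> verts G"
  have "address_val ` ipaths G u
      = (\<Union>e\<in>out_arcs G u. (\<lambda>\<pi>. address_val (case_nat e \<pi>)) ` ipaths G (head G e))"
    by (subst ipaths_Cons) (simp add: image_UN image_image)
  also have "\<dots> = (\<Union>e\<in>out_arcs G u. S e ` address_val ` ipaths G (head G e))"
    by (intro SUP_cong refl) (simp add: address_val_Cons image_image cong: image_cong)
  finally show "address_val ` ipaths G u = (\<Union>v\<in>verts G.
      \<Union>e\<in>{e \<in> arcs G. tail G e = u \<and> head G e = v}. S e ` address_val ` ipaths G v)"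
    using attractor_Union_out_arcs[OF u, of "\<lambda>v. address_val ` ipaths G v"] by simp
qed

text \<open>Uniqueness of the attractor in explicit form. All points involved stay in the bounded
  union of the finitely many sets \<open>K u\<close>, so that the remainders after \<open>N\<close> steps, which are such
  points divided by \<open>\<beta> ^ N\<close>, tend to \<open>0\<close> in both inclusions.\<close>

theorem attractor_eq_address_val_ipaths:
  assumes K: "is_attractor G S K" and v: "v \<in> verts G"
  shows "K v = address_val ` ipaths G v"
proof -
  note K_prop = attractorD(1,2)[OF K] and K_eq = attractorD(3)[OF K]
  have "bounded (\<Union>u\<in>verts G. K u)"
    by (rule bounded_UN[OF finite_verts]) (intro ballI compact_imp_bounded K_prop(2))
  then have bdd: "bounded (range x)" if "\<And>i. x i \<in> (\<Union>u\<in>verts G. K u)" for x :: "nat \<Rightarrow> real ^ 'n"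
    by (rule bounded_subset) (rule image_subsetI, rule that)
  show ?thesis
  proof (intro equalityI subsetI)
    fix x assume "x \<in> K v"
    have pull_back: "\<exists>p. fst p \<in> arcs G \<and> snd p \<in> K (head G (fst p))
        \<and> tail G (fst p) = u \<and> S (fst p) (snd p) = z" if u: "u \<in> verts G" and z: "z \<in> K u" for u z
    proof -
      obtain e y where "e \<in> out_arcs G u" "y \<in> K (head G e)" "z = S e y"
        using z unfolding K_eq[OF u] by blast
      then show ?thesis
        by (intro exI[of _ "(e, y)"]) (simp add: out_arcs_def)
    qed
    \<comment> \<open>Pulling \<open>x\<close> back for ever: \<open>f i\<close> pairs the arc number \<open>i\<close> of the path with the
      preimage of \<open>x\<close> reached at its head.\<close>
    have "\<exists>f. \<forall>i. (fst (f i) \<in> arcs G \<and> snd (f i) \<in> K (head G (fst (f i)))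
          \<and> (i = 0 \<longrightarrow> tail G (fst (f i)) = v \<and> S (fst (f i)) (snd (f i)) = x))
        \<and> head G (fst (f i)) = tail G (fst (f (Suc i)))
          \<and> snd (f i) = S (fst (f (Suc i))) (snd (f (Suc i)))"
    proof (rule dependent_nat_choice)
      show "\<exists>p. fst p \<in> arcs G \<and> snd p \<in> K (head G (fst p))
          \<and> (0 = (0::nat) \<longrightarrow> tail G (fst p) = v \<and> S (fst p) (snd p) = x)"
        using pull_back[OF v \<open>x \<in> K v\<close>] by simp
    next
      fix p and n :: nat
      assume p: "fst p \<in> arcs G \<and> snd p \<in> K (head G (fst p))
          \<and> (n = 0 \<longrightarrow> tail G (fst p) = v \<and> S (fst p) (snd p) = x)"
      obtain q where "fst q \<in> arcs G \<and> snd q \<in> K (head G (fst q))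
          \<and> tail G (fst q) = head G (fst p) \<and> S (fst q) (snd q) = snd p"
        using pull_back[of "head G (fst p)" "snd p"] p head_in_verts by blast
      then show "\<exists>q. (fst q \<in> arcs G \<and> snd q \<in> K (head G (fst q))
          \<and> (Suc n = 0 \<longrightarrow> tail G (fst q) = v \<and> S (fst q) (snd q) = x))
          \<and> head G (fst p) = tail G (fst q) \<and> snd p = S (fst q) (snd q)"
        by (intro exI[of _ q]) simp
    qed
    then obtain f where f: "\<forall>i. (fst (f i) \<in> arcs G \<and> snd (f i) \<in> K (head G (fst (f i)))
          \<and> (i = 0 \<longrightarrow> tail G (fst (f i)) = v \<and> S (fst (f i)) (snd (f i)) = x))
        \<and> head G (fst (f i)) = tail G (fst (f (Suc i)))
          \<and> snd (f i) = S (fst (f (Suc i))) (snd (f (Suc i)))" ..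
    have arcs: "fst (f i) \<in> arcs G" and in_K: "snd (f i) \<in> K (head G (fst (f i)))"
      and link: "head G (fst (f i)) = tail G (fst (f (Suc i)))"
      and step: "snd (f i) = S (fst (f (Suc i))) (snd (f (Suc i)))" for i
      using spec[OF f, of i] by blast+
    have start: "tail G (fst (f 0)) = v" "S (fst (f 0)) (snd (f 0)) = x"
      using spec[OF f, of 0] by blast+
    define \<pi> where "\<pi> i = fst (f i)" for i
    \<comment> \<open>The orbit of preimages, shifted so that it begins with \<open>x\<close> itself.\<close>
    define z where "z = case_nat x (\<lambda>i. snd (f i))"
    have "\<pi> \<in> ipaths G v"
      using arcs link start by (simp add: ipaths_def \<pi>_def)
    moreover have "address_val \<pi> = x"
    proof -
      have "z i \<in> (\<Union>u\<in>verts G. K u)" for i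
      proof (cases i)
        case 0
        then show ?thesis using \<open>x \<in> K v\<close> v by (auto simp: z_def)
      next
        case (Suc k)
        then show ?thesis using in_K[of k] head_in_verts[OF arcs[of k]] by (auto simp: z_def)
      qed
      moreover have "z i = digit_map \<beta> (a (\<pi> i)) (z (Suc i))" for i
      proof (cases i)
        case 0
        then show ?thesis using start(2) digit[OF arcs[of 0]] by (simp add: z_def \<pi>_def)
      next
        case (Suc k)
        then show ?thesis using step[of k] digit[OF arcs[of "Suc k"]] by (simp add: z_def \<pi>_def)
      qed
      ultimately have "val_frac \<beta> (\<lambda>i. a (\<pi> i)) = z 0"
        by (intro val_frac_eqI base_gt_1 bdd)
      then show ?thesis
        by (simp add: address_val_def z_def)
    qed
    ultimately show "x \<in> address_val ` ipaths G v"
      by blast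
  next
    fix x assume "x \<in> address_val ` ipaths G v"
    then obtain \<pi> where \<pi>: "\<pi> \<in> ipaths G v" and x: "x = address_val \<pi>"
      by blast
    have arcs: "\<pi> i \<in> arcs G" and link: "head G (\<pi> i) = tail G (\<pi> (Suc i))"
      and start: "tail G (\<pi> 0) = v" for i
      using \<pi> by (auto simp: ipaths_def)
    define s where "s N = (\<Sum>i<N. (1 / \<beta> ^ Suc i) *\<^sub>R real_vec (a (\<pi> i)))" for N
    \<comment> \<open>The left-hand side is the composition of the first \<open>N\<close> maps of the path applied to
      \<open>y\<close>.\<close>
    have in_K: "s N + (1 / \<beta> ^ N) *\<^sub>R y \<in> K v" if "y \<in> K (tail G (\<pi> N))" for N y
      using that
    proof (induction N arbitrary: y)
      case 0
      then show ?case by (simp add: s_def start)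
    next
      case (Suc N)
      have "S (\<pi> N) y \<in> K (tail G (\<pi> N))"
        using Suc.prems arcs[of N] link[of N] by (subst K_eq) (auto simp: out_arcs_def)
      from Suc.IH[OF this] show ?case
        using base_gt_1 arcs[of N]
        by (simp add: digit digit_map_expansion s_def add.assoc del: power_Suc)
    qed
    have "\<exists>y. \<forall>N. y N \<in> K (tail G (\<pi> N))"
      using K_prop(1) arcs tail_in_verts by (intro choice) blast
    then obtain y where y: "\<And>N. y N \<in> K (tail G (\<pi> N))"
      by blast
    obtain M where "\<And>e. e \<in> arcs G \<Longrightarrow> norm (real_vec (a e)) \<le> M"
      using obtain_digit_bound by blast
    then have "summable (\<lambda>i. (1 / \<beta> ^ Suc i) *\<^sub>R real_vec (a (\<pi> i)))"
      using arcs base_gt_1 by (intro summable_val_frac) auto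
    then have "s \<longlonglongrightarrow> x"
      unfolding s_def x address_val_def val_frac_def by (rule summable_LIMSEQ)
    moreover have "(\<lambda>N. (1 / \<beta> ^ N) *\<^sub>R y N) \<longlonglongrightarrow> 0"
    proof (intro remainder_tendsto_0 base_gt_1 bdd)
      show "y N \<in> (\<Union>u\<in>verts G. K u)" for N
        using tail_in_verts[OF arcs[of N]] y[of N] by (rule UN_I)
    qed
    ultimately have "(\<lambda>N. s N + (1 / \<beta> ^ N) *\<^sub>R y N) \<longlonglongrightarrow> x + 0"
      by (rule tendsto_add)
    then have "(\<lambda>N. s N + (1 / \<beta> ^ N) *\<^sub>R y N) \<longlonglongrightarrow> x"
      by simp
    from closed_sequentially[OF compact_imp_closed[OF K_prop(2)[OF v]] in_K[OF y] this]
    show "x \<in> K v" .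
  qed
qed

end

section \<open>Runs of closed automata\<close>

definition run :: "('q, 'a) buchi \<Rightarrow> (nat \<Rightarrow> 'q) \<Rightarrow> (nat \<Rightarrow> 'a) \<Rightarrow> bool" where
  "run \<A> \<rho> u \<longleftrightarrow> (\<forall>i. (\<rho> i, u i, \<rho> (Suc i)) \<in> trans \<A>)"

definition run_words :: "('q, 'a) buchi \<Rightarrow> 'q \<Rightarrow> (nat \<Rightarrow> 'a) set" where
  "run_words \<A> q = {u. \<exists>\<rho>. \<rho> 0 = q \<and> run \<A> \<rho> u}"

lemma run_reaches:
  assumes "run \<A> \<rho> u" and "i < j"
  shows "(\<rho> i, \<rho> j) \<in> (step_rel \<A>)\<^sup>+"
  using assms(2)
proof (induction j rule: strict_inc_induct[where P = "\<lambda>i. (\<rho> i, \<rho> j) \<in> (step_rel \<A>)\<^sup>+" for j])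
  case (base i)
  then show ?case
    using assms(1) by (auto simp: run_def step_rel_def)
next
  case (step i)
  then show ?case
    using assms(1) by (auto simp: run_def step_rel_def intro: trancl_into_trancl2)
qed

text \<open>By the pigeonhole principle a run visits some state infinitely often. Two of the visits
  exhibit a cycle through that state, which is therefore final.\<close>

lemma closed_run_accepting:
  assumes "buchi_automaton A \<A>" and "buchi_closed \<A>" and run: "run \<A> \<rho> u"
  shows "\<exists>\<^sub>\<infinity>i. \<rho> i \<in> final \<A>"
proof -
  have in_states: "\<rho> i \<in> states \<A>" for i
    using assms(1) run by (auto simp: buchi_automaton_def run_def)
  have "finite (range \<rho>)"
    using in_states assms(1) by (auto simp: buchi_automaton_def intro: finite_subset)
  then obtain q where q: "infinite (\<rho> -` {q})"
    using inf_img_fin_domE[of \<rho> UNIV] by auto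
  then have inf: "\<exists>\<^sub>\<infinity>i. \<rho> i = q"
    by (simp add: INFM_iff_infinite vimage_def)
  then obtain i where i: "\<rho> i = q"
    by (auto simp: INFM_nat)
  from inf obtain j where j: "\<rho> j = q" "i < j"
    by (auto simp: INFM_nat)
  have "(q, q) \<in> (step_rel \<A>)\<^sup>+"
    using run_reaches[OF run \<open>i < j\<close>] i j by simp
  then have "q \<in> final \<A>"
    using assms(2) in_states[of i] i by (auto simp: buchi_closed_def)
  with inf show ?thesis
    by (auto elim: INFM_mono)
qed

lemma closed_buchi_lang:
  assumes "buchi_automaton A \<A>" and "buchi_closed \<A>"
  shows "buchi_lang \<A> = (\<Union>q\<in>initial \<A>. run_words \<A> q)"
  using closed_run_accepting[OF assms]
  by (auto simp: buchi_lang_def buchi_accepts_def run_words_def run_def)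

text \<open>The dictionary between runs and paths. The hypotheses concern only the runs and paths
  that start in \<open>q\<close>, since graph and automaton may differ in parts that \<open>q\<close> cannot reach or that
  admit no infinite run.\<close>

lemma run_words_eq_ipaths:
  assumes arc: "\<And>\<pi> i. \<pi> \<in> ipaths G q \<Longrightarrow>
      (tail G (\<pi> i), a (\<pi> i), head G (\<pi> i)) \<in> trans \<A>"
    and tr: "\<And>\<rho> u i. \<rho> 0 = q \<Longrightarrow> run \<A> \<rho> u \<Longrightarrow>
      (\<rho> i, u i, \<rho> (Suc i)) \<in> (\<lambda>e. (tail G e, a e, head G e)) ` arcs G"
  shows "run_words \<A> q = (\<lambda>\<pi> i. a (\<pi> i)) ` ipaths G q"
proof (intro equalityI subsetI)
  fix u assume "u \<in> run_words \<A> q"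
  then obtain \<rho> where \<rho>: "\<rho> 0 = q" "run \<A> \<rho> u"
    by (auto simp: run_words_def)
  have "\<exists>\<pi>. \<forall>i. \<pi> i \<in> arcs G \<and> (\<rho> i, u i, \<rho> (Suc i)) = (tail G (\<pi> i), a (\<pi> i), head G (\<pi> i))"
    using tr[OF \<rho>] by (intro choice) blast
  then obtain \<pi> where \<pi>: "\<forall>i. \<pi> i \<in> arcs G \<and>
      (\<rho> i, u i, \<rho> (Suc i)) = (tail G (\<pi> i), a (\<pi> i), head G (\<pi> i))" ..
  then have "\<pi> \<in> ipaths G q"
    using \<rho>(1) by (simp add: ipaths_def) metis
  moreover have "u = (\<lambda>i. a (\<pi> i))"
    using \<pi> by auto
  ultimately show "u \<in> (\<lambda>\<pi> i. a (\<pi> i)) ` ipaths G q"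
    by blast
next
  fix u assume "u \<in> (\<lambda>\<pi> i. a (\<pi> i)) ` ipaths G q"
  then obtain \<pi> where \<pi>: "\<pi> \<in> ipaths G q" "u = (\<lambda>i. a (\<pi> i))"
    by blast
  then have "run \<A> (\<lambda>i. tail G (\<pi> i)) u"
    unfolding run_def using arc[OF \<pi>(1)] by (auto simp: ipaths_def)
  then show "u \<in> run_words \<A> q"
    using \<pi>(1) by (auto simp: run_words_def ipaths_def)
qed

section \<open>From automata to iterated function systems and back\<close>

lemma finite_letters:
  assumes "finite C"
  shows "finite (letters C :: (int ^ 'n) set)"
proof (rule finite_subset)
  show "(letters C :: (int ^ 'n) set) \<subseteq> vec_lambda ` (PiE UNIV (\<lambda>_. C))"
  proof
    fix b :: "int ^ 'n" assume "b \<in> letters C"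
    then have "vec_nth b \<in> PiE UNIV (\<lambda>_. C)"
      by (auto simp: letters_def)
    then have "vec_lambda (vec_nth b) \<in> vec_lambda ` (PiE UNIV (\<lambda>_. C))"
      by (rule imageI)
    then show "b \<in> vec_lambda ` (PiE UNIV (\<lambda>_. C))"
      by simp
  qed
  show "finite (vec_lambda ` (PiE (UNIV :: 'n set) (\<lambda>_. C)))"
    using assms by (intro finite_imageI finite_PiE) auto
qed

lemma gdifs_of_closed_automaton:
  fixes \<A> :: "('q, int ^ 'n) buchi"
  assumes \<beta>: "\<beta> > 1" and fin: "finite C"
    and und: "underlying_automaton \<beta> C \<A> X" and closed: "buchi_closed \<A>"
  shows "\<exists>(G :: ('q, nat) pre_digraph) (S :: nat \<Rightarrow> real ^ 'n \<Rightarrow> real ^ 'n) K \<F>.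
             gdifs G S \<and>
             (\<forall>e\<in>arcs G. \<exists>a\<in>letters C. S e = digit_map \<beta> a) \<and>
             is_attractor G S K \<and>
             finite \<F> \<and> \<F> \<subseteq> K ` verts G \<and> X = \<Union>\<F>"
proof -
  have aut: "buchi_automaton (letters C) \<A>" and X: "X = val_frac \<beta> ` buchi_lang \<A>"
    using und by (auto simp: underlying_automaton_def)
  \<comment> \<open>Only states with an infinite run become vertices: every vertex of the system needs an
    outgoing arc, and the other states contribute no accepted word.\<close>
  define live where "live = {q \<in> states \<A>. run_words \<A> q \<noteq> {}}"
  define T where "T = {t \<in> trans \<A>. snd (snd t) \<in> live}"
  have fin_states: "finite (states \<A>)" and trans: "trans \<A> \<subseteq> states \<A> \<times> letters C \<times> states \<A>"
    using aut by (auto simp: buchi_automaton_def)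
  have "finite (trans \<A>)"
    by (rule finite_subset[OF trans])
      (intro finite_cartesian_product fin_states finite_letters fin)
  then have "finite T"
    by (simp add: T_def)
  \<comment> \<open>Arcs are numbers that index the transitions between the remaining states.\<close>
  then obtain h where h: "bij_betw h {0..<card T} T"
    using ex_bij_betw_nat_finite by blast
  define G where "G = \<lparr>verts = live, arcs = {0..<card T},
    tail = \<lambda>e. fst (h e), head = \<lambda>e. snd (snd (h e))\<rparr>"
  define a where "a e = fst (snd (h e))" for e
  define S where "S e = digit_map \<beta> (a e)" for e
  have T_eq: "(\<lambda>e. (tail G e, a e, head G e)) ` arcs G = T"
    using h by (simp add: bij_betw_def G_def a_def)
  have run_shift: "run \<A> (\<lambda>i. \<rho> (i + k)) (\<lambda>i. u (i + k))" if "run \<A> \<rho> u" for \<rho> u k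
    using that by (auto simp: run_def)
  have live_run: "\<rho> i \<in> live" if "run \<A> \<rho> u" for \<rho> u i
  proof -
    have "\<rho> i \<in> states \<A>"
      using that trans by (auto simp: run_def)
    moreover have "(\<lambda>j. u (j + i)) \<in> run_words \<A> (\<rho> i)"
      using run_shift[OF that, of i]
      by (auto simp: run_words_def intro!: exI[of _ "\<lambda>j. \<rho> (j + i)"])
    ultimately show ?thesis
      by (auto simp: live_def)
  qed
  have live_pred: "p \<in> live" if t: "(p, b, q) \<in> T" for p b q
  proof -
    obtain \<rho> u where "\<rho> 0 = q" "run \<A> \<rho> u"
      using t by (auto simp: T_def live_def run_words_def)
    then have "run \<A> (case_nat p \<rho>) (case_nat b u)"
      using t by (auto simp: run_def T_def split: nat.split)
    from live_run[OF this, of 0] show ?thesis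
      by simp
  qed
  have words: "run_words \<A> q = (\<lambda>\<pi> i. a (\<pi> i)) ` ipaths G q" for q
  proof (rule run_words_eq_ipaths)
    fix \<pi> i assume "\<pi> \<in> ipaths G q"
    then have "(tail G (\<pi> i), a (\<pi> i), head G (\<pi> i)) \<in> T"
      by (auto simp: ipaths_def simp flip: T_eq)
    then show "(tail G (\<pi> i), a (\<pi> i), head G (\<pi> i)) \<in> trans \<A>"
      by (simp add: T_def)
  next
    fix \<rho> u i assume "run \<A> \<rho> u"
    then show "(\<rho> i, u i, \<rho> (Suc i)) \<in> (\<lambda>e. (tail G e, a e, head G e)) ` arcs G"
      unfolding T_eq using live_run by (auto simp: T_def run_def)
  qed
  have arc_T: "(tail G e, a e, head G e) \<in> T" if "e \<in> arcs G" for e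
    using that T_eq by blast
  interpret digit_gdifs G S \<beta> a
  proof unfold_locales
    fix e assume e: "e \<in> arcs G"
    show "tail G e \<in> verts G" "head G e \<in> verts G"
      using live_pred[OF arc_T[OF e]] arc_T[OF e] by (auto simp: G_def T_def)
    show "similarity (S e)"
      unfolding S_def using \<beta> by (intro similarity_digit_map) simp
    show "S e = digit_map \<beta> (a e)"
      by (simp add: S_def)
  next
    show "finite (verts G)" "finite (arcs G)"
      using fin_states by (auto simp: G_def live_def)
    show "\<beta> > 1" by fact
  next
    fix v assume "v \<in> verts G"
    then have "run_words \<A> v \<noteq> {}"
      by (simp add: G_def live_def)
    then obtain \<pi> where "\<pi> \<in> ipaths G v"
      by (auto simp: words)
    then have "\<pi> 0 \<in> out_arcs G v"
      by (auto simp: ipaths_def out_arcs_def)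
    then show "out_arcs G v \<noteq> {}"
      by blast
  qed
  define K where "K = (\<lambda>v. address_val ` ipaths G v)"
  have K_eq: "K v = val_frac \<beta> ` run_words \<A> v" for v
    by (simp add: K_def words address_val_def image_image)
  have "X = \<Union>(K ` initial \<A>)"
    by (simp add: X closed_buchi_lang[OF aut closed] K_eq image_UN)
  also have "\<dots> = \<Union>(K ` (initial \<A> \<inter> live))"
    using aut by (auto simp: K_eq live_def buchi_automaton_def)
  finally have "X = \<Union>(K ` (initial \<A> \<inter> live))" .
  moreover have "finite (K ` (initial \<A> \<inter> live))" "K ` (initial \<A> \<inter> live) \<subseteq> K ` verts G"
    using fin_states by (auto simp: G_def live_def)
  moreover have "\<exists>b\<in>letters C. S e = digit_map \<beta> b" if "e \<in> arcs G" for e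
    using arc_T[OF that] trans by (auto simp: S_def T_def)
  moreover have "is_attractor G S K"
    using address_val_ipaths_is_attractor by (simp add: K_def)
  ultimately show ?thesis
    using gdifs_axioms by blast
qed

lemma closed_automaton_of_gdifs:
  fixes G :: "('v, 'e::discrete_topology) pre_digraph" and S :: "'e \<Rightarrow> real ^ 'n \<Rightarrow> real ^ 'n"
  assumes \<beta>: "\<beta> > 1" and gd: "gdifs G S"
    and dig: "\<And>e. e \<in> arcs G \<Longrightarrow> \<exists>a\<in>letters C. S e = digit_map \<beta> a"
    and K: "is_attractor G S K" and \<F>: "\<F> \<subseteq> K ` verts G"
  shows "\<exists>\<A> :: ('v, int ^ 'n) buchi.
    underlying_automaton \<beta> C \<A> (\<Union>\<F>) \<and> buchi_trim \<A> \<and> buchi_closed \<A>"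
proof -
  have "\<exists>a. \<forall>e\<in>arcs G. a e \<in> letters C \<and> S e = digit_map \<beta> (a e)"
    using dig by (intro bchoice) blast
  then obtain a where a: "\<And>e. e \<in> arcs G \<Longrightarrow> a e \<in> letters C"
      "\<And>e. e \<in> arcs G \<Longrightarrow> S e = digit_map \<beta> (a e)"
    by blast
  interpret digit_gdifs G S \<beta> a
    using gd \<beta> a(2) by (simp add: digit_gdifs_def digit_gdifs_axioms_def)
  \<comment> \<open>Only the part reachable from the chosen vertices is kept, so that all states are
    accessible; as all of them are final, they are also co-accessible and the automaton is
    closed.\<close>
  define I where "I = {v \<in> verts G. K v \<in> \<F>}"
  define R where "R = {(tail G e, head G e) | e. e \<in> arcs G}"
  define Q where "Q = R\<^sup>* `` I"
  define \<A> where "\<A> = \<lparr>states = Q,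
    trans = {(tail G e, a e, head G e) | e. e \<in> arcs G \<and> tail G e \<in> Q},
    initial = I, final = Q\<rparr>"
  have "q \<in> verts G" if "(p, q) \<in> R\<^sup>*" "p \<in> verts G" for p q
    using that by (induction rule: rtrancl_induct) (auto simp: R_def)
  then have Q_verts: "Q \<subseteq> verts G"
    by (auto simp: Q_def I_def)
  have I_Q: "I \<subseteq> Q"
    by (auto simp: Q_def)
  have Q_step: "head G e \<in> Q" if "e \<in> arcs G" "tail G e \<in> Q" for e
    using that by (auto simp: Q_def R_def intro: rtrancl_into_rtrancl)
  have aut: "buchi_automaton (letters C) \<A>"
    using finite_subset[OF Q_verts] I_Q Q_step a(1)
    by (auto simp: buchi_automaton_def \<A>_def)
  have closed: "buchi_closed \<A>"
    by (simp add: buchi_closed_def \<A>_def)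
  have "(p, q) \<in> (step_rel \<A>)\<^sup>*" if "(p, q) \<in> R\<^sup>*" "p \<in> I" for p q
    using that(1)
  proof (induction rule: rtrancl_induct)
    case (step q r)
    have "q \<in> Q"
      using step.hyps(1) that(2) by (auto simp: Q_def)
    with step.hyps(2) have "(q, r) \<in> step_rel \<A>"
      by (auto simp: step_rel_def \<A>_def R_def)
    with step.IH show ?case
      by (rule rtrancl_into_rtrancl)
  qed simp
  then have trim: "buchi_trim \<A>"
    by (auto simp: buchi_trim_def accessible_def coaccessible_def \<A>_def Q_def)
  have words: "run_words \<A> q = (\<lambda>\<pi> i. a (\<pi> i)) ` ipaths G q" if "q \<in> Q" for q
  proof (rule run_words_eq_ipaths)
    fix \<pi> i assume \<pi>: "\<pi> \<in> ipaths G q"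
    have "tail G (\<pi> i) \<in> Q"
    proof (induction i)
      case 0
      show ?case using \<pi> that by (simp add: ipaths_def)
    next
      case (Suc i)
      have "\<pi> i \<in> arcs G" "head G (\<pi> i) = tail G (\<pi> (Suc i))"
        using \<pi> by (auto simp: ipaths_def)
      then show ?case
        using Q_step[of "\<pi> i"] Suc by simp
    qed
    then show "(tail G (\<pi> i), a (\<pi> i), head G (\<pi> i)) \<in> trans \<A>"
      using \<pi> by (auto simp: \<A>_def ipaths_def)
  next
    fix \<rho> u i assume "run \<A> \<rho> u"
    then have "(\<rho> i, u i, \<rho> (Suc i)) \<in> trans \<A>"
      by (simp add: run_def)
    then show "(\<rho> i, u i, \<rho> (Suc i)) \<in> (\<lambda>e. (tail G e, a e, head G e)) ` arcs G"
      by (auto simp: \<A>_def)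
  qed
  have "K q = val_frac \<beta> ` run_words \<A> q" if "q \<in> I" for q
    using that I_Q attractor_eq_address_val_ipaths[OF K, of q]
    by (auto simp: words I_def address_val_def image_image subset_iff)
  then have "val_frac \<beta> ` buchi_lang \<A> = \<Union>(K ` I)"
    by (simp add: closed_buchi_lang[OF aut closed] image_UN) (simp add: \<A>_def)
  also have "K ` I = \<F>"
    using \<F> by (auto simp: I_def)
  finally show ?thesis
    using aut trim closed by (auto simp: underlying_automaton_def)
qed

theorem theorem57:
  fixes \<beta> :: real and c :: int and C :: "int set" and X :: "(real ^ 'n) set"
  assumes "\<beta> > 1" and "c \<ge> 1" and "C = {- c..c}"
  shows "(acceptable \<beta> C X \<and>
          (\<exists>\<A> :: (nat, int ^ 'n) buchi.
             underlying_automaton \<beta> C \<A> X \<and> buchi_trim \<A> \<and> buchi_closed \<A>))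
     \<longleftrightarrow>
         (\<exists>(G :: (nat, nat) pre_digraph) (S :: nat \<Rightarrow> real ^ 'n \<Rightarrow> real ^ 'n) K \<F>.
             gdifs G S \<and>
             (\<forall>e\<in>arcs G. \<exists>a\<in>letters C. S e = digit_map \<beta> a) \<and>
             is_attractor G S K \<and>
             finite \<F> \<and> \<F> \<subseteq> K ` verts G \<and> X = \<Union>\<F>)"
    (is "?automaton \<longleftrightarrow> ?gdifs")
proof
  assume ?automaton
  then obtain \<A> :: "(nat, int ^ 'n) buchi"
    where "underlying_automaton \<beta> C \<A> X" "buchi_closed \<A>"
    by blast
  moreover have "finite C"
    using assms by simp
  ultimately show ?gdifs
    using gdifs_of_closed_automaton \<open>\<beta> > 1\<close> by blast
next
  assume ?gdifs
  then obtain G :: "(nat, nat) pre_digraph" and S :: "nat \<Rightarrow> real ^ 'n \<Rightarrow> real ^ 'n" and K \<F>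
    where "gdifs G S" "\<And>e. e \<in> arcs G \<Longrightarrow> \<exists>a\<in>letters C. S e = digit_map \<beta> a"
      "is_attractor G S K" "\<F> \<subseteq> K ` verts G" "X = \<Union>\<F>"
    by blast
  then show ?automaton
    using closed_automaton_of_gdifs[OF \<open>\<beta> > 1\<close>, of G S C K \<F>]
    by (auto simp: acceptable_def)
qed

end
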